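(* Let $r\ge 0$, $k\ge 3$ and $m\ge r+k$ be integers, and let $F(k,m,r)$ be the largest integer $n'$ such that there exists an $r\text{-ECBC}(n',k,m)$ in which each column has cardinality $r+k-2$. Then $F(k,m,r)\le\frac{k-1}{r+k-1}\binom{m}{r+k-2}$, and for every integer $n$ with $$(k-1)\binom{m}{r+k-1}-(m-r-k+1)\cdot F(k,m,r)\le n\le (k-1)\binom{m}{r+k-1}$$ one has $$N(n,k,m;r)=(r+k-1)n-\left\lfloor\frac{(k-1)\binom{m}{r+k-1}-n}{m-r-k+1}\right\rfloor.$$
   Context: For a nonnegative integer $s$, $[s]=\{1,\dots,s\}$. An $r\text{-ECBC}(n,k,m)$ (erasure combinatorial batch code with redundancy $r$, with at most one item read from each server) is a multifamily $\mathcal{B}=\{B_1,\dots,B_m\}$ of $m$ subsets of $[n]$ such that for each $Y\subseteq[n]$ with $|Y|\le k$ and each $J\subseteq[m]$ with $|J|\ge m-r$ there exist subsets $C_j\subseteq B_j$ ($j\in J$) with $|C_j|\le 1$ and $Y=\bigcup_{j\in J}C_j$. The parameters of an $r\text{-ECBC}(n,k,m)$ are always assumed to satisfy $r<m$ and $1\le k\le\min\{n,m-r\}$. Its weight is $N(\mathcal{B})=|B_1|+\cdots+|B_m|$. $N(n,k,m;r)$ denotes the minimum weight of an $r\text{-ECBC}(n,k,m)$. For $j\in[n]$, the $j$-th column of $\mathcal{B}$ is the set $A_j=\{i\in[m]: j\in B_i\}$ (the servers storing item $j$). *)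

theory Defs
  imports Complex_Main
begin

text \<open>
  A multifamily of \<open>m\<close> subsets of \<open>[n]\<close> is a function \<open>B :: nat \<Rightarrow> nat set\<close> on the
  indices \<open>{1..m}\<close>; values of \<open>B\<close> outside \<open>{1..m}\<close> are irrelevant. The first
  conjuncts are the standing assumptions on the parameters.
\<close>

definition ECBC :: "nat \<Rightarrow> nat \<Rightarrow> nat \<Rightarrow> nat \<Rightarrow> (nat \<Rightarrow> nat set) \<Rightarrow> bool" where
  "ECBC r n k m B \<longleftrightarrow>
     r < m \<and> 1 \<le> k \<and> k \<le> min n (m - r) \<and>
     (\<forall>i\<in>{1..m}. B i \<subseteq> {1..n}) \<and>
     (\<forall>Y J. Y \<subseteq> {1..n} \<and> card Y \<le> k \<and> J \<subseteq> {1..m} \<and> card J \<ge> m - r \<longrightarrow>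
        (\<exists>C. (\<forall>j\<in>J. C j \<subseteq> B j \<and> card (C j) \<le> 1) \<and> Y = (\<Union>j\<in>J. C j)))"

definition weight :: "nat \<Rightarrow> (nat \<Rightarrow> nat set) \<Rightarrow> nat" where
  "weight m B = (\<Sum>i=1..m. card (B i))"

definition column :: "nat \<Rightarrow> (nat \<Rightarrow> nat set) \<Rightarrow> nat \<Rightarrow> nat set" where
  "column m B j = {i \<in> {1..m}. j \<in> B i}"

definition min_weight :: "nat \<Rightarrow> nat \<Rightarrow> nat \<Rightarrow> nat \<Rightarrow> nat" where
  "min_weight n k m r = (LEAST w. \<exists>B. ECBC r n k m B \<and> weight m B = w)"

definition max_items :: "nat \<Rightarrow> nat \<Rightarrow> nat \<Rightarrow> nat" where
  "max_items k m r =
     (GREATEST n. \<exists>B. ECBC r n k m B \<and> (\<forall>j\<in>{1..n}. card (column m B j) = r + k - 2))"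

end

theory Submission
  imports Defs
begin

text \<open>
  Write \<open>s = r + k - 1\<close> and \<open>t = m - s\<close>, so that \<open>t \<ge> 1\<close>. By Hall's theorem a family of
  columns is an \<open>r\<close>-ECBC iff any \<open>i\<close> columns with \<open>1 \<le> i \<le> k\<close> cover at least \<open>r + i\<close> servers
  (\<open>ECBC_imp_expanding\<close>, \<open>ECBC_if_expanding\<close>). In particular an \<open>s\<close>-set of servers contains at
  most \<open>k - 1\<close> columns, and counting the pairs of a column and an \<open>s\<close>-set around it gives at most
  \<open>(k - 1) * (m choose s)\<close> pairs (\<open>sum_supersets_le\<close>).

  A column of size \<open>a \<le> s\<close> lies in \<open>(m - a) choose (s - a)\<close> sets of size \<open>s\<close>. This number is at
  least \<open>1 + t * (s - a)\<close>, and for \<open>a > s\<close> that linear expression is at most \<open>0\<close>, so it is a lower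
  bound for every column. Summed over all columns it bounds the amount \<open>s * n - N(B)\<close> by which the
  weight can stay below \<open>s * n\<close> (\<open>weight_deficit_le\<close>). If all columns have size \<open>s - 1\<close>, each lies
  in exactly \<open>t + 1\<close> sets of size \<open>s\<close>, which bounds their number (\<open>small_code_bound\<close>); this is the
  first claim.

  The linear bound is attained by columns of size \<open>s\<close> and \<open>s - 1\<close>. Hence the lower bound on the
  weight is reached by a code with as many columns of size \<open>s - 1\<close> as the bound permits, namely
  the rounded quotient \<open>q\<close> in the theorem, and all others of size \<open>s\<close>. The lower limit on \<open>n\<close>
  ensures that \<open>q\<close> is at most the number of columns in a largest code whose columns all have size
  \<open>s - 1\<close>, so \<open>q\<close> columns can be taken from such a code. Columns of size \<open>s\<close> can then be added
  freely as long as no \<open>s\<close>-set contains more than \<open>k - 1\<close> columns: they do not fit into any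
  smaller set, so only the count in the \<open>s\<close>-sets can be violated
  (\<open>ex_code_with_small_columns\<close>).
\<close>

section \<open>Hall's theorem\<close>

text \<open>
  The argument of Halmos and Vaughan: if a proper subfamily is tight, represent it first and remove
  its union from the remaining sets; otherwise every proper subfamily has an element to spare, and
  any representative may be chosen for one of the sets.
\<close>

lemma hall_sdr:
  assumes "finite I" and "\<And>i. i \<in> I \<Longrightarrow> finite (A i)"
    and "\<And>Z. Z \<subseteq> I \<Longrightarrow> card Z \<le> card (\<Union>(A ` Z))"
  shows "\<exists>f. inj_on f I \<and> (\<forall>i\<in>I. f i \<in> A i)"
  using assms
proof (induction I arbitrary: A rule: finite_psubset_induct)
  case (psubset I)
  note fin = \<open>finite I\<close> and finA = psubset.prems(1) and hall = psubset.prems(2)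
  have finU: "finite (\<Union>(A ` Z))" if "Z \<subseteq> I" for Z
    using that finA fin by (meson finite_UN finite_subset subsetD)
  consider "I = {}"
    | (tight) Z where "Z \<subset> I" "Z \<noteq> {}" "card (\<Union>(A ` Z)) = card Z"
    | (loose) "I \<noteq> {}" "\<And>Z. Z \<subset> I \<Longrightarrow> Z \<noteq> {} \<Longrightarrow> card Z < card (\<Union>(A ` Z))"
    using hall by (metis le_neq_implies_less psubset_imp_subset)
  then show ?case
  proof cases
    case 1
    then show ?thesis by simp
  next
    case tight
    let ?U = "\<Union>(A ` Z)"
    have "\<exists>f. inj_on f Z \<and> (\<forall>i\<in>Z. f i \<in> A i)"
      using tight(1) finA hall by (intro psubset.IH) auto
    then obtain f where f: "inj_on f Z" "\<And>i. i \<in> Z \<Longrightarrow> f i \<in> A i"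
      by blast
    have "\<exists>g. inj_on g (I - Z) \<and> (\<forall>i\<in>I - Z. g i \<in> A i - ?U)"
    proof (rule psubset.IH)
      show "I - Z \<subset> I"
        using tight by blast
      show "finite (A i - ?U)" if "i \<in> I - Z" for i
        using that finA by blast
      show "card W \<le> card (\<Union>i\<in>W. A i - ?U)" if "W \<subseteq> I - Z" for W
      proof -
        have ZI: "W \<subseteq> I" "Z \<subseteq> I" "W \<inter> Z = {}"
          using that tight by auto
        have "card W + card Z = card (W \<union> Z)"
          using ZI fin by (metis card_Un_disjoint finite_subset)
        also have "\<dots> \<le> card (\<Union>(A ` (W \<union> Z)))"
          using ZI by (intro hall) auto
        also have "\<Union>(A ` (W \<union> Z)) = (\<Union>i\<in>W. A i - ?U) \<union> ?U"
          by auto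
        also have "card \<dots> \<le> card (\<Union>i\<in>W. A i - ?U) + card ?U"
          by (rule card_Un_le)
        finally show ?thesis
          using tight(3) by simp
      qed
    qed
    then obtain g where g: "inj_on g (I - Z)" "\<And>i. i \<in> I - Z \<Longrightarrow> g i \<in> A i - ?U"
      by blast
    define h where "h i = (if i \<in> Z then f i else g i)" for i
    have hA: "h i \<in> A i" if "i \<in> I" for i
      using f g that unfolding h_def by auto
    have "inj_on h I"
    proof (rule inj_onI)
      fix x y assume xy: "x \<in> I" "y \<in> I" "h x = h y"
      have "h i \<in> ?U \<longleftrightarrow> i \<in> Z" if "i \<in> I" for i
        using f(2) g(2) that unfolding h_def by auto
      then have "x \<in> Z \<longleftrightarrow> y \<in> Z"
        using xy by metis
      then show "x = y"
        using xy f(1) g(1) unfolding h_def by (auto dest: inj_onD split: if_splits)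
    qed
    then show ?thesis
      using hA by blast
  next
    case loose
    then obtain x where x: "x \<in> I"
      by blast
    have "card {x} \<le> card (\<Union>(A ` {x}))"
      using x by (intro hall) auto
    then obtain a where a: "a \<in> A x"
      by fastforce
    have "\<exists>g. inj_on g (I - {x}) \<and> (\<forall>i\<in>I - {x}. g i \<in> A i - {a})"
    proof (rule psubset.IH)
      show "I - {x} \<subset> I"
        using x by blast
      show "finite (A i - {a})" if "i \<in> I - {x}" for i
        using that finA by blast
      show "card W \<le> card (\<Union>i\<in>W. A i - {a})" if "W \<subseteq> I - {x}" for W
      proof (cases "W = {}")
        case False
        then have "card W < card (\<Union>(A ` W))"
          using that x by (intro loose) auto
        moreover have "(\<Union>i\<in>W. A i - {a}) = \<Union>(A ` W) - {a}"
          by auto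
        ultimately show ?thesis
          by (auto simp: card_Diff_singleton_if)
      qed simp
    qed
    then obtain g where g: "inj_on g (I - {x})" "\<And>i. i \<in> I - {x} \<Longrightarrow> g i \<in> A i - {a}"
      by blast
    have "inj_on (g(x := a)) I"
      using g by (auto simp: inj_on_def)
    moreover have "\<forall>i\<in>I. (g(x := a)) i \<in> A i"
      using g(2) a by auto
    ultimately show ?thesis
      by blast
  qed
qed

section \<open>Codes as families of columns\<close>

text \<open>
  Hall's condition for requests of at most \<open>k\<close> items after the loss of any \<open>r\<close> servers, expressed
  without mentioning the lost servers.
\<close>

definition expanding :: "nat \<Rightarrow> nat \<Rightarrow> nat set \<Rightarrow> (nat \<Rightarrow> nat set) \<Rightarrow> bool" where
  "expanding r k I A \<longleftrightarrow>
     (\<forall>Y\<subseteq>I. Y \<noteq> {} \<longrightarrow> card Y \<le> k \<longrightarrow> r + card Y \<le> card (\<Union>(A ` Y)))"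

lemma expandingD:
  "expanding r k I A \<Longrightarrow> Y \<subseteq> I \<Longrightarrow> Y \<noteq> {} \<Longrightarrow> card Y \<le> k \<Longrightarrow> r + card Y \<le> card (\<Union>(A ` Y))"
  by (simp add: expanding_def)

lemma expanding_subset: "expanding r k I A \<Longrightarrow> I' \<subseteq> I \<Longrightarrow> expanding r k I' A"
  by (auto simp: expanding_def)

lemma column_subset: "column m B j \<subseteq> {1..m}"
  by (auto simp: column_def)

text \<open>
  Deleting up to \<open>r\<close> servers from the union of the columns of \<open>Y\<close> leaves a set of servers that
  must still deliver every item of \<open>Y\<close>, one item each.
\<close>

lemma ECBC_imp_expanding:
  assumes "ECBC r n k m B"
  shows "expanding r k {1..n} (column m B)"
  unfolding expanding_def
proof (intro allI impI)
  fix Y assume Y: "Y \<subseteq> {1..n}" "Y \<noteq> {}" "card Y \<le> k"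
  let ?U = "\<Union>(column m B ` Y)"
  have U: "?U \<subseteq> {1..m}" "finite ?U"
    using column_subset finite_subset[of ?U "{1..m}"] by blast+
  obtain R where R: "R \<subseteq> ?U" "card R = min r (card ?U)"
    by (metis min.cobounded2 obtain_subset_with_card_n)
  define J where "J = {1..m} - R"
  have finR: "finite R"
    using R(1) U(2) finite_subset by blast
  have "card J = m - card R"
    unfolding J_def using R(1) U(1) finR by (subst card_Diff_subset) auto
  then have "m - r \<le> card J"
    using R(2) by simp
  moreover have "J \<subseteq> {1..m}"
    by (auto simp: J_def)
  ultimately obtain C where C: "\<And>j. j \<in> J \<Longrightarrow> C j \<subseteq> B j \<and> card (C j) \<le> 1"
      "Y = (\<Union>j\<in>J. C j)"
    using assms Y unfolding ECBC_def by metis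
  \<comment> \<open>Only servers that store an item of \<open>Y\<close> can contribute to \<open>Y\<close>.\<close>
  have UN_C: "Y = (\<Union>j\<in>?U - R. C j)"
  proof -
    have in_U: "j \<in> ?U - R" if "j \<in> J" "y \<in> C j" for j y
    proof -
      have "y \<in> Y" "y \<in> B j" "j \<in> {1..m}" "j \<notin> R"
        using that C J_def by blast+
      then show ?thesis
        by (auto simp: column_def)
    qed
    have "?U - R \<subseteq> J"
      using U(1) by (auto simp: J_def)
    then have "(\<Union>j\<in>?U - R. C j) = (\<Union>j\<in>J. C j)"
      by (intro equalityI UN_mono subset_refl UN_least[OF subsetI[OF UN_I[OF in_U]]])
    then show ?thesis
      by (simp only: C(2)[symmetric])
  qed
  from UN_C have "card Y = card (\<Union>j\<in>?U - R. C j)"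
    by (rule arg_cong)
  also have "\<dots> \<le> (\<Sum>j\<in>?U - R. card (C j))"
    using U(2) by (intro card_UN_le) simp
  also have "\<dots> \<le> (\<Sum>j\<in>?U - R. 1)"
    using C(1) U(1) by (intro sum_mono) (auto simp: J_def)
  also have "\<dots> = card ?U - card R"
    using R(1) finR by (simp add: card_Diff_subset)
  finally have "card Y \<le> card ?U - min r (card ?U)"
    using R(2) by simp
  moreover have "card Y > 0"
    using Y finite_subset[of Y] by (simp add: card_gt_0_iff)
  ultimately show "r + card Y \<le> card ?U"
    by linarith
qed

text \<open>
  At most \<open>r\<close> servers are missing, so the surviving parts of the columns satisfy Hall's condition,
  and a system of distinct representatives tells each server which item to deliver.
\<close>

lemma ECBC_if_expanding:
  assumes "r < m" "1 \<le> k" "k \<le> min n (m - r)"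
    and BI: "\<forall>i\<in>{1..m}. B i \<subseteq> {1..n}"
    and exp: "expanding r k {1..n} (column m B)"
  shows "ECBC r n k m B"
proof -
  have "\<exists>C. (\<forall>j\<in>J. C j \<subseteq> B j \<and> card (C j) \<le> 1) \<and> Y = (\<Union>j\<in>J. C j)"
    if Y: "Y \<subseteq> {1..n}" "card Y \<le> k" and J: "J \<subseteq> {1..m}" "m - r \<le> card J" for Y J
  proof -
    have finY: "finite Y"
      using Y(1) finite_subset by blast
    have finJ: "finite J"
      using J(1) finite_subset by blast
    have lost: "card ({1..m} - J) \<le> r"
      using J finJ by (simp add: card_Diff_subset)
    have "\<exists>f. inj_on f Y \<and> (\<forall>y\<in>Y. f y \<in> column m B y \<inter> J)"
    proof (rule hall_sdr)
      show "card Z \<le> card (\<Union>y\<in>Z. column m B y \<inter> J)" if "Z \<subseteq> Y" for Z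
      proof (cases "Z = {}")
        case False
        have "card Z \<le> k"
          using that Y(2) finY card_mono by (meson le_trans)
        then have "r + card Z \<le> card (\<Union>(column m B ` Z))"
          using expandingD[OF exp] False that Y(1) by blast
        also have "\<dots> \<le> card ((\<Union>y\<in>Z. column m B y \<inter> J) \<union> ({1..m} - J))"
          using finJ column_subset[of m B] by (intro card_mono) (auto intro: finite_subset[OF _ finJ])
        also have "\<dots> \<le> card (\<Union>y\<in>Z. column m B y \<inter> J) + card ({1..m} - J)"
          by (rule card_Un_le)
        finally show ?thesis
          using lost by linarith
      qed simp
    qed (use finY finJ in auto)
    then obtain f where f: "inj_on f Y" "\<And>y. y \<in> Y \<Longrightarrow> f y \<in> column m B y \<inter> J"
      by blast
    define C where "C j = {y \<in> Y. f y = j}" for j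
    have "card (C j) \<le> 1" for j
      using f(1) finY by (auto simp: C_def inj_on_def card_le_Suc0_iff_eq)
    moreover have "C j \<subseteq> B j" for j
      using f(2) by (auto simp: C_def column_def)
    moreover have "Y = (\<Union>j\<in>J. C j)"
      using f(2) by (auto simp: C_def)
    ultimately show ?thesis
      by blast
  qed
  then show ?thesis
    using assms unfolding ECBC_def by blast
qed

text \<open>
  The code with prescribed columns: the transpose of \<open>column\<close>.
\<close>

definition servers :: "nat \<Rightarrow> (nat \<Rightarrow> nat set) \<Rightarrow> nat \<Rightarrow> nat set" where
  "servers n A i = {j \<in> {1..n}. i \<in> A j}"

lemma column_servers:
  "j \<in> {1..n} \<Longrightarrow> A j \<subseteq> {1..m} \<Longrightarrow> column m (servers n A) j = A j"
  by (auto simp: column_def servers_def)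

lemma ECBC_servers:
  assumes "r + k \<le> m" "1 \<le> k" "k \<le> n"
    and A: "\<And>j. j \<in> {1..n} \<Longrightarrow> A j \<subseteq> {1..m}" and exp: "expanding r k {1..n} A"
  shows "ECBC r n k m (servers n A)"
proof (rule ECBC_if_expanding)
  have "\<Union>(column m (servers n A) ` Y) = \<Union>(A ` Y)" if "Y \<subseteq> {1..n}" for Y
    using column_servers[of _ n A m] A that by (intro SUP_cong refl) blast
  then show "expanding r k {1..n} (column m (servers n A))"
    using exp by (simp add: expanding_def)
qed (use assms(1-3) in \<open>auto simp: servers_def\<close>)

lemma sum_card_incidence:
  assumes "finite X" "finite Y"
  shows "(\<Sum>x\<in>X. card {y \<in> Y. R x y}) = (\<Sum>y\<in>Y. card {x \<in> X. R x y})"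
proof -
  have "(\<Sum>x\<in>X. card {y \<in> Y. R x y}) = (\<Sum>x\<in>X. \<Sum>y\<in>Y. if R x y then 1 else 0)"
    using assms by (simp add: sum.If_cases Collect_conj_eq)
  also have "\<dots> = (\<Sum>y\<in>Y. \<Sum>x\<in>X. if R x y then 1 else 0)"
    by (rule sum.swap)
  also have "\<dots> = (\<Sum>y\<in>Y. card {x \<in> X. R x y})"
    using assms by (simp add: sum.If_cases Collect_conj_eq)
  finally show ?thesis .
qed

lemma weight_eq_sum_columns:
  assumes "\<forall>i\<in>{1..m}. B i \<subseteq> {1..n}"
  shows "weight m B = (\<Sum>j=1..n. card (column m B j))"
proof -
  have "weight m B = (\<Sum>i=1..m. card {j \<in> {1..n}. j \<in> B i})"
    unfolding weight_def using assms
    by (intro sum.cong refl arg_cong[where f = card]) (blast dest: bspec)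
  also have "\<dots> = (\<Sum>j=1..n. card {i \<in> {1..m}. j \<in> B i})"
    by (rule sum_card_incidence) auto
  finally show ?thesis
    by (simp add: column_def)
qed

section \<open>Counting columns inside sets of servers\<close>

lemma card_supersets:
  assumes "finite M" "A \<subseteq> M" "card A \<le> s"
  shows "card {S. S \<subseteq> M \<and> card S = s \<and> A \<subseteq> S} = (card M - card A) choose (s - card A)"
proof -
  have finA: "finite A"
    using assms finite_subset by blast
  have "bij_betw (\<lambda>T. T \<union> A) {T. T \<subseteq> M - A \<and> card T = s - card A}
          {S. S \<subseteq> M \<and> card S = s \<and> A \<subseteq> S}"
  proof (rule bij_betw_byWitness[where f' = "\<lambda>S. S - A"])
    show "(\<lambda>T. T \<union> A) ` {T. T \<subseteq> M - A \<and> card T = s - card A}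
            \<subseteq> {S. S \<subseteq> M \<and> card S = s \<and> A \<subseteq> S}"
    proof (rule image_subsetI)
      fix T assume T: "T \<in> {T. T \<subseteq> M - A \<and> card T = s - card A}"
      then have "finite T" "T \<inter> A = {}"
        using assms(1) finite_subset by blast+
      then have "card (T \<union> A) = s"
        using T finA assms(3) by (simp add: card_Un_disjoint)
      then show "T \<union> A \<in> {S. S \<subseteq> M \<and> card S = s \<and> A \<subseteq> S}"
        using T assms(2) by auto
    qed
    show "(\<lambda>S. S - A) ` {S. S \<subseteq> M \<and> card S = s \<and> A \<subseteq> S}
            \<subseteq> {T. T \<subseteq> M - A \<and> card T = s - card A}"
      using finA by (auto simp: card_Diff_subset)
  qed auto
  then have "card {S. S \<subseteq> M \<and> card S = s \<and> A \<subseteq> S}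
      = card {T. T \<subseteq> M - A \<and> card T = s - card A}"
    by (simp add: bij_betw_same_card)
  also have "\<dots> = card (M - A) choose (s - card A)"
    using assms(1) by (intro n_subsets) auto
  finally show ?thesis
    using assms(2) finA by (simp add: card_Diff_subset)
qed

lemma card_columns_within:
  assumes "expanding r k I A" "finite I" "1 \<le> k" "finite S" "card S = r + k - 1"
  shows "card {j \<in> I. A j \<subseteq> S} \<le> k - 1"
proof (rule ccontr)
  assume "\<not> ?thesis"
  then have "k \<le> card {j \<in> I. A j \<subseteq> S}"
    by simp
  from obtain_subset_with_card_n[OF this]
  obtain Y where Y: "Y \<subseteq> {j \<in> I. A j \<subseteq> S}" "card Y = k"
    by blast
  then have "r + card Y \<le> card (\<Union>(A ` Y))"
    using assms(3) by (intro expandingD[OF assms(1)]) auto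
  also have "\<dots> \<le> card S"
    using Y(1) assms(4) by (intro card_mono) auto
  finally show False
    using assms(3,5) Y(2) by simp
qed

lemma sum_supersets_le:
  assumes "expanding r k I A" "finite I" "1 \<le> k"
  shows "(\<Sum>j\<in>I. card {S. S \<subseteq> {1..m} \<and> card S = r + k - 1 \<and> A j \<subseteq> S})
           \<le> (k - 1) * (m choose (r + k - 1))"
proof -
  let ?Ss = "{S. S \<subseteq> {1..m} \<and> card S = r + k - 1}"
  have "(\<Sum>j\<in>I. card {S. S \<subseteq> {1..m} \<and> card S = r + k - 1 \<and> A j \<subseteq> S})
      = (\<Sum>j\<in>I. card {S \<in> ?Ss. A j \<subseteq> S})"
    by (simp add: conj_assoc)
  also have "\<dots> = (\<Sum>S\<in>?Ss. card {j \<in> I. A j \<subseteq> S})"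
    using assms(2) by (intro sum_card_incidence) auto
  also have "\<dots> \<le> (\<Sum>S\<in>?Ss. k - 1)"
    using assms by (intro sum_mono card_columns_within[OF assms(1)])
      (auto intro: finite_subset)
  also have "\<dots> = (k - 1) * (m choose (r + k - 1))"
    by (simp add: n_subsets)
  finally show ?thesis .
qed

text \<open>
  By Pascal's rule, each step in \<open>i\<close> adds \<open>(t + i) choose (i + 1) = (t + i) choose (t - 1)\<close>, which
  is at least \<open>t choose (t - 1) = t\<close>.
\<close>

lemma binomial_ge_linear:
  assumes "1 \<le> t"
  shows "1 + t * i \<le> (t + i) choose i"
proof (induction i)
  case (Suc i)
  have "t \<le> (t + i) choose Suc i"
  proof -
    have "t = t choose (t - 1)"
      using assms binomial_symmetric[of 1 t] by simp
    also have "\<dots> \<le> (t + i) choose (t - 1)"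
      by (intro binomial_right_mono) simp
    also have "\<dots> = (t + i) choose Suc i"
      using assms binomial_symmetric[of "Suc i" "t + i"] by simp
    finally show ?thesis .
  qed
  then show ?case
    using Suc by simp
qed simp

text \<open>
  The integer subtraction is essential: it makes the bound meaningful also for columns larger than
  \<open>s\<close>, where the right-hand side is \<open>0\<close> and the left-hand side is at most \<open>1 - (m - s) \<le> 0\<close>.
\<close>

lemma card_supersets_ge:
  assumes "A \<subseteq> {1..m}" "s < m"
  shows "1 + (int m - int s) * (int s - int (card A))
           \<le> int (card {S. S \<subseteq> {1..m} \<and> card S = s \<and> A \<subseteq> S})"
proof (cases "card A \<le> s")
  case True
  have "1 + (m - s) * (s - card A) \<le> (m - s + (s - card A)) choose (s - card A)"
    using assms(2) by (intro binomial_ge_linear) simp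
  also have "m - s + (s - card A) = m - card A"
    using True assms(2) by simp
  also have "(m - card A) choose (s - card A)
      = card {S. S \<subseteq> {1..m} \<and> card S = s \<and> A \<subseteq> S}"
    using card_supersets[OF _ assms(1) True] by simp
  finally have "int (1 + (m - s) * (s - card A))
      \<le> int (card {S. S \<subseteq> {1..m} \<and> card S = s \<and> A \<subseteq> S})"
    by (simp only: of_nat_le_iff)
  then show ?thesis
    using True assms(2) by (simp add: of_nat_diff)
next
  case False
  then have "1 \<le> (int m - int s) * (int (card A) - int s)"
    using assms(2) by (simp add: int_one_le_iff_zero_less)
  then have "1 + (int m - int s) * (int s - int (card A)) \<le> 0"
    by (simp add: algebra_simps)
  then show ?thesis
    by linarith
qed

text \<open>
  The lower bound on the weight: the left-hand side is the sum over all columns of the linear bound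
  in \<open>card_supersets_ge\<close>.
\<close>

lemma weight_deficit_le:
  assumes "ECBC r n k m B" "r + k \<le> m"
  shows "int n + (int m - int (r + k - 1)) * (int (r + k - 1) * int n - int (weight m B))
           \<le> int ((k - 1) * (m choose (r + k - 1)))"
proof -
  let ?s = "r + k - 1"
  have k: "1 \<le> k" and BI: "\<forall>i\<in>{1..m}. B i \<subseteq> {1..n}"
    using assms(1) by (auto simp: ECBC_def)
  have "int n + (int m - int ?s) * (int ?s * int n - int (weight m B))
      = (\<Sum>j=1..n. 1 + (int m - int ?s) * (int ?s - int (card (column m B j))))"
    by (simp add: weight_eq_sum_columns[OF BI] sum.distrib sum_subtractf
        flip: sum_distrib_left)
  also have "\<dots> \<le> (\<Sum>j=1..n. int (card {S. S \<subseteq> {1..m} \<and> card S = ?s \<and> column m B j \<subseteq> S}))"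
    using k assms(2) by (intro sum_mono card_supersets_ge column_subset) simp
  also have "\<dots> = int (\<Sum>j=1..n. card {S. S \<subseteq> {1..m} \<and> card S = ?s \<and> column m B j \<subseteq> S})"
    by simp
  also have "\<dots> \<le> int ((k - 1) * (m choose ?s))"
    using sum_supersets_le[OF ECBC_imp_expanding[OF assms(1)] _ k]
    by (simp only: of_nat_le_iff finite_atLeastAtMost)
  finally show ?thesis .
qed

section \<open>Filling up with large columns\<close>

text \<open>
  Each \<open>S\<close> offers \<open>c S\<close> places; map \<open>P\<close> injectively into the places and forget which place of \<open>S\<close>
  was taken.
\<close>

lemma ex_map_bounded_fibres:
  assumes "finite P" "finite Q" "card P \<le> (\<Sum>S\<in>Q. c S)"
  shows "\<exists>g. (\<forall>j\<in>P. g j \<in> Q) \<and> (\<forall>S\<in>Q. card {j \<in> P. g j = S} \<le> c S)"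
proof -
  let ?D = "SIGMA S:Q. {..<c S}"
  have fin: "finite ?D"
    by (rule finite_SigmaI[OF assms(2)]) simp
  have "card P \<le> card ?D"
    using assms(2,3) by (simp add: card_SigmaI)
  from card_le_inj[OF assms(1) fin this]
  obtain h where h: "h ` P \<subseteq> ?D" "inj_on h P"
    by (elim exE conjE)
  have hD: "fst (h j) \<in> Q \<and> snd (h j) < c (fst (h j))" if "j \<in> P" for j
  proof -
    have "h j \<in> ?D"
      by (rule subsetD[OF h(1) imageI[OF that]])
    then show ?thesis
      by (elim SigmaE) simp
  qed
  have "card {j \<in> P. fst (h j) = S} \<le> c S" for S
  proof -
    have "card {j \<in> P. fst (h j) = S} \<le> card {..<c S}"
    proof (rule card_inj_on_le)
      show "inj_on (\<lambda>j. snd (h j)) {j \<in> P. fst (h j) = S}"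
        using h(2) by (intro inj_onI) (simp add: inj_on_def prod_eq_iff)
      show "(\<lambda>j. snd (h j)) ` {j \<in> P. fst (h j) = S} \<subseteq> {..<c S}"
        using hD by auto
    qed simp
    then show ?thesis
      by simp
  qed
  then show ?thesis
    using hD by (intro exI[of _ "\<lambda>j. fst (h j)"]) simp
qed

text \<open>
  The optimal codes. An \<open>(r + k - 1)\<close>-set can take as many further columns equal to itself as
  it lacks from \<open>k - 1\<close>. Each of the \<open>q\<close> given columns uses up one place in each of the
  \<open>m - (r + k - 1) + 1\<close> sets that contain it, so the last premise says precisely that the remaining
  places suffice for the other \<open>n - q\<close> columns.
\<close>

lemma ex_code_with_small_columns:
  assumes k: "2 \<le> k" and m: "r + k \<le> m" and n: "k \<le> n" "q \<le> n"
    and A: "\<And>j. j \<in> {1..q} \<Longrightarrow> A j \<subseteq> {1..m} \<and> card (A j) = r + k - 2"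
    and exp: "expanding r k {1..q} A"
    and room: "n + (m - (r + k - 1)) * q \<le> (k - 1) * (m choose (r + k - 1))"
  shows "\<exists>B. ECBC r n k m B \<and> weight m B + q = (r + k - 1) * n"
proof -
  let ?s = "r + k - 1"
  let ?Ss = "{S. S \<subseteq> {1..m} \<and> card S = ?s}"
  have finS: "finite S" if "S \<in> ?Ss" for S
    using that finite_subset by blast
  \<comment> \<open>the number of places that the given columns leave free in \<open>S\<close>\<close>
  define c where "c S = k - 1 - card {j \<in> {1..q}. A j \<subseteq> S}" for S
  have le: "card {j \<in> {1..q}. A j \<subseteq> S} \<le> k - 1" if "S \<in> ?Ss" for S
    using that k finS[OF that] by (intro card_columns_within[OF exp]) auto
  have sup: "card {S \<in> ?Ss. A j \<subseteq> S} = m - ?s + 1" if "j \<in> {1..q}" for j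
  proof -
    have "card {S \<in> ?Ss. A j \<subseteq> S} = (m - card (A j)) choose (?s - card (A j))"
      using card_supersets[of "{1..m}" "A j" ?s] A[OF that] by (simp add: conj_assoc)
    moreover have "?s - card (A j) = 1" "m - card (A j) = m - ?s + 1"
      using A[OF that] k m by auto
    ultimately show ?thesis
      by simp
  qed
  have "(\<Sum>S\<in>?Ss. c S) + (m - ?s + 1) * q
      = (\<Sum>S\<in>?Ss. c S) + (\<Sum>j\<in>{1..q}. card {S \<in> ?Ss. A j \<subseteq> S})"
    using sup by simp
  also have "(\<Sum>j\<in>{1..q}. card {S \<in> ?Ss. A j \<subseteq> S}) = (\<Sum>S\<in>?Ss. card {j \<in> {1..q}. A j \<subseteq> S})"
    by (rule sum_card_incidence) auto
  also have "(\<Sum>S\<in>?Ss. c S) + \<dots> = (\<Sum>S\<in>?Ss. k - 1)"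
    unfolding sum.distrib[symmetric] c_def
    by (intro sum.cong refl le_add_diff_inverse2 le)
  also have "\<dots> = (k - 1) * (m choose ?s)"
    by (simp add: n_subsets)
  finally have "card {q+1..n} \<le> (\<Sum>S\<in>?Ss. c S)"
    using room n(2) unfolding add_mult_distrib card_atLeastAtMost by linarith
  from ex_map_bounded_fibres[OF _ _ this]
  obtain g where "\<forall>j\<in>{q+1..n}. g j \<in> ?Ss"
      "\<forall>S\<in>?Ss. card {j \<in> {q+1..n}. g j = S} \<le> c S"
    by (auto simp del: mem_Collect_eq atLeastAtMost_iff)
  then have g: "\<And>j. j \<in> {q+1..n} \<Longrightarrow> g j \<in> ?Ss"
      "\<And>S. S \<in> ?Ss \<Longrightarrow> card {j \<in> {q+1..n}. g j = S} \<le> c S"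
    by blast+
  define D where "D j = (if j \<le> q then A j else g j)" for j
  have D: "D j \<subseteq> {1..m}" "card (D j) = (if j \<le> q then ?s - 1 else ?s)" if "j \<in> {1..n}" for j
  proof -
    have "D j \<subseteq> {1..m} \<and> card (D j) = (if j \<le> q then ?s - 1 else ?s)"
    proof (cases "j \<le> q")
      case True
      then show ?thesis
        using A[of j] that by (simp add: D_def)
    next
      case False
      then show ?thesis
        using g(1)[of j] that by (simp add: D_def)
    qed
    then show "D j \<subseteq> {1..m}" "card (D j) = (if j \<le> q then ?s - 1 else ?s)"
      by blast+
  qed
  have "expanding r k {1..n} D"
    unfolding expanding_def
  proof (intro allI impI, rule ccontr)
    fix Y assume Y: "Y \<subseteq> {1..n}" "Y \<noteq> {}" "card Y \<le> k"
    let ?U = "\<Union>(D ` Y)"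
    assume small: "\<not> r + card Y \<le> card ?U"
    have U: "?U \<subseteq> {1..m}" "finite ?U"
      using D(1) Y(1) finite_subset[of ?U "{1..m}"] by blast+
    show False
    proof (cases "card ?U < ?s")
      case True
      \<comment> \<open>A union of fewer than \<open>r + k - 1\<close> servers has no room for an added column.\<close>
      have "j \<le> q" if "j \<in> Y" for j
      proof (rule ccontr)
        assume "\<not> j \<le> q"
        then have "card (D j) = ?s"
          using D(2) that Y(1) by auto
        moreover have "card (D j) \<le> card ?U"
          using that U(2) by (intro card_mono) auto
        ultimately show False
          using True by simp
      qed
      then have "Y \<subseteq> {1..q}" "?U = \<Union>(A ` Y)"
        using Y(1) by (auto simp: D_def)
      then show False
        using expandingD[OF exp _ Y(2,3)] small by simp
    next
      case False
      \<comment> \<open>The only other critical case is a full \<open>k\<close>-set of columns inside one \<open>(r + k - 1)\<close>-set.\<close>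
      then have cU: "card ?U = ?s" "card Y = k"
        using small Y(3) k by linarith+
      then have US: "?U \<in> ?Ss"
        using U(1) by blast
      have "Y \<subseteq> {j \<in> {1..q}. A j \<subseteq> ?U} \<union> {j \<in> {q+1..n}. g j = ?U}"
      proof
        fix j assume j: "j \<in> Y"
        then have DU: "D j \<subseteq> ?U"
          by auto
        have jn: "j \<in> {1..n}"
          using j Y(1) by blast
        show "j \<in> {j \<in> {1..q}. A j \<subseteq> ?U} \<union> {j \<in> {q+1..n}. g j = ?U}"
        proof (cases "j \<le> q")
          case True
          then have "A j \<subseteq> ?U" "j \<in> {1..q}"
            using DU jn by (simp_all only: D_def if_True atLeastAtMost_iff)
          then show ?thesis
            by blast
        next
          case False
          then have "card (D j) = card ?U"
            using D(2)[OF jn] cU(1) by (simp only: if_False)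
          then have "D j = ?U"
            by (rule card_subset_eq[OF U(2) DU])
          moreover have "D j = g j" "j \<in> {q+1..n}"
            using False jn by (simp_all add: D_def)
          ultimately show ?thesis
            by (intro UnI2 CollectI conjI) (simp_all only:)
        qed
      qed
      then have "card Y \<le> card ({j \<in> {1..q}. A j \<subseteq> ?U} \<union> {j \<in> {q+1..n}. g j = ?U})"
        by (intro card_mono) auto
      also have "\<dots> \<le> card {j \<in> {1..q}. A j \<subseteq> ?U} + card {j \<in> {q+1..n}. g j = ?U}"
        by (rule card_Un_le)
      also have "\<dots> \<le> k - 1"
        using g(2)[OF US] le[OF US] unfolding c_def by linarith
      finally show False
        using cU(2) k by simp
    qed
  qed
  then have E: "ECBC r n k m (servers n D)"
    using k m n D(1) by (intro ECBC_servers) auto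
  have "weight m (servers n D) = (\<Sum>j=1..n. card (D j))"
  proof -
    have "\<forall>i\<in>{1..m}. servers n D i \<subseteq> {1..n}"
      by (auto simp: servers_def)
    then have "weight m (servers n D) = (\<Sum>j=1..n. card (column m (servers n D) j))"
      by (rule weight_eq_sum_columns)
    also have "\<dots> = (\<Sum>j=1..n. card (D j))"
      using D(1) by (intro sum.cong refl) (simp add: column_servers)
    finally show ?thesis .
  qed
  moreover have "(\<Sum>j=1..n. card (D j)) + q = (\<Sum>j=1..n. card (D j)) + (\<Sum>j=1..n. if j \<le> q then 1 else 0)"
  proof -
    have "{1..n} \<inter> {j. j \<le> q} = {1..q}"
      using n(2) by auto
    then show ?thesis
      by (simp add: sum.If_cases)
  qed
  moreover have "\<dots> = (\<Sum>j=1..n. ?s)"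
    unfolding sum.distrib[symmetric] using D(2) k by (intro sum.cong) auto
  ultimately have "weight m (servers n D) + q = ?s * n"
    by simp
  then show ?thesis
    using E by blast
qed

section \<open>Codes with all columns of size \<open>r + k - 2\<close>\<close>

abbreviation small_code :: "nat \<Rightarrow> nat \<Rightarrow> nat \<Rightarrow> nat \<Rightarrow> (nat \<Rightarrow> nat set) \<Rightarrow> bool" where
  "small_code k m r n B \<equiv>
     ECBC r n k m B \<and> (\<forall>j\<in>{1..n}. card (column m B j) = r + k - 2)"

text \<open>
  Here the count of pairs is exact: a column lacks a single server to become an \<open>(r + k - 1)\<close>-set,
  and every server outside it will do.
\<close>

lemma small_code_bound:
  assumes "2 \<le> k" "r + k \<le> m" "small_code k m r n B"
  shows "n * (m - (r + k - 1) + 1) \<le> (k - 1) * (m choose (r + k - 1))"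
proof -
  let ?s = "r + k - 1"
  have "card {S. S \<subseteq> {1..m} \<and> card S = ?s \<and> column m B j \<subseteq> S} = m - ?s + 1"
    if "j \<in> {1..n}" for j
  proof -
    have a: "card (column m B j) = r + k - 2"
      using assms(3) that by blast
    have "card {S. S \<subseteq> {1..m} \<and> card S = ?s \<and> column m B j \<subseteq> S}
        = (m - (r + k - 2)) choose (?s - (r + k - 2))"
      using card_supersets[of "{1..m}" "column m B j" ?s] a column_subset by simp
    moreover have "?s - (r + k - 2) = 1" "m - (r + k - 2) = m - ?s + 1"
      using assms by auto
    ultimately show ?thesis
      by simp
  qed
  then have "n * (m - ?s + 1)
      = (\<Sum>j=1..n. card {S. S \<subseteq> {1..m} \<and> card S = ?s \<and> column m B j \<subseteq> S})"
    by simp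
  also have "\<dots> \<le> (k - 1) * (m choose ?s)"
    using assms by (intro sum_supersets_le ECBC_imp_expanding) auto
  finally show ?thesis .
qed

text \<open>
  The maximum that defines \<open>max_items\<close> is taken over a nonempty set, which needs a witness. On
  the first \<open>r + k\<close> servers, take as columns the complements of the edges of a triangle, where one
  edge is repeated \<open>k - 2\<close> times. The condition on \<open>i\<close> columns is then that their \<open>i\<close> edges have
  at most \<open>k - i\<close> common vertices: all edges together have none, two different ones have at most one,
  and at most \<open>k - 2\<close> of them are equal.
\<close>

lemma ex_small_code:
  assumes "3 \<le> k" "r + k \<le> m"
  shows "\<exists>B. small_code k m r k B"
proof -
  define E :: "nat \<Rightarrow> nat set" where
    "E j = (if j = 1 then {2,3} else if j = 2 then {1,3} else {1,2})" for j
  define A where "A j = {1..r + k} - E j" for j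
  have E: "E j \<subseteq> {1..r + k}" "card (E j) = 2" "finite (E j)" for j
    using assms(1) by (auto simp: E_def)
  have cA: "card (A j) = r + k - 2" for j
    unfolding A_def using E by (simp add: card_Diff_subset)
  have Am: "A j \<subseteq> {1..m}" for j
    unfolding A_def using assms(2) by auto
  have "expanding r k {1..k} A"
    unfolding expanding_def
  proof (intro allI impI)
    fix Y assume Y: "Y \<subseteq> {1..k}" "Y \<noteq> {}" "card Y \<le> k"
    let ?I = "\<Inter>(E ` Y)"
    have finY: "finite Y"
      using Y(1) finite_subset by blast
    have IE: "?I \<subseteq> E j" if "j \<in> Y" for j
      using that by auto
    obtain y where y: "y \<in> Y"
      using Y(2) by blast
    have finI: "finite ?I" "?I \<subseteq> {1..r + k}" "card ?I \<le> 2"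
      using finite_subset[OF IE[OF y] E(3)] order_trans[OF IE[OF y] E(1)]
        card_mono[OF E(3) IE[OF y]] E(2)[of y] by auto
    have "\<Union>(A ` Y) = {1..r + k} - ?I"
      using Y(2) by (auto simp: A_def)
    then have cU: "card (\<Union>(A ` Y)) = r + k - card ?I"
      using finI by (simp add: card_Diff_subset)
    have "card ?I + card Y \<le> k"
    proof (cases "{1, 2, 3} \<subseteq> Y")
      case True
      then have "?I \<subseteq> E 1 \<inter> E 2 \<inter> E 3"
        by auto
      then have "?I = {}"
        by (auto simp: E_def)
      then show ?thesis
        using Y(3) by simp
    next
      case False
      show ?thesis
      proof (cases "\<exists>i\<in>{1,2}. \<exists>j\<in>Y. i \<in> Y \<and> j \<noteq> i")
        case True
        then obtain i j where ij: "i \<in> {1,2}" "i \<in> Y" "j \<in> Y" "j \<noteq> i"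
          by blast
        have "?I \<subseteq> E i \<inter> E j"
          using ij by auto
        moreover have "card (E i \<inter> E j) \<le> 1"
          using ij(1,4) by (auto simp: E_def Int_insert_left)
        moreover have "finite (E i \<inter> E j)"
          using E(3) by blast
        ultimately have "card ?I \<le> 1"
          by (meson card_mono le_trans)
        moreover have "{1, 2, 3} \<subseteq> {1..k}"
          using assms(1) by auto
        then have "Y \<subset> {1..k}"
          using False Y(1) by blast
        then have "card Y < k"
          using psubset_card_mono[of "{1..k}" Y] by simp
        ultimately show ?thesis
          by linarith
      next
        case no: False
        have "card Y \<le> k - 2"
        proof (cases "1 \<in> Y \<or> 2 \<in> Y")
          case True
          then obtain i where "i \<in> {1, 2}" "i \<in> Y"
            by blast
          then have "Y = {i}"
            using no by blast
          then show ?thesis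
            using assms(1) by simp
        next
          case False
          have "j \<in> {3..k}" if "j \<in> Y" for j
          proof -
            have "j \<noteq> 1" "j \<noteq> 2" "1 \<le> j" "j \<le> k"
              using False that Y(1) by auto
            then show ?thesis
              by simp
          qed
          then have "card Y \<le> card {3..k}"
            by (intro card_mono) auto
          then show ?thesis
            by simp
        qed
        then show ?thesis
          using assms(1) finI(3) by linarith
      qed
    qed
    then show "r + card Y \<le> card (\<Union>(A ` Y))"
      using cU by simp
  qed
  then have "ECBC r k k m (servers k A)"
    using assms Am by (intro ECBC_servers) auto
  moreover have "\<forall>j\<in>{1..k}. card (column m (servers k A) j) = r + k - 2"
    using Am cA by (simp add: column_servers)
  ultimately show ?thesis
    by blast
qed

lemma max_items_small_code:
  assumes "3 \<le> k" "r + k \<le> m"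
  shows "\<exists>B. small_code k m r (max_items k m r) B"
  unfolding max_items_def
proof (rule GreatestI_ex_nat)
  show "\<exists>n B. small_code k m r n B"
    using ex_small_code[OF assms] by blast
  show "n \<le> (k - 1) * (m choose (r + k - 1))" if ex: "\<exists>B. small_code k m r n B" for n
  proof -
    obtain B where "small_code k m r n B"
      using ex by blast
    then have "n * (m - (r + k - 1) + 1) \<le> (k - 1) * (m choose (r + k - 1))"
      using assms by (intro small_code_bound) auto
    then show ?thesis
      by (simp add: algebra_simps)
  qed
qed

section \<open>The minimum weight\<close>

lemma min_weight_eqI:
  assumes "ECBC r n k m B" "weight m B = w"
    and "\<And>B. ECBC r n k m B \<Longrightarrow> w \<le> weight m B"
  shows "min_weight n k m r = w"
  unfolding min_weight_def using assms by (intro Least_equality) blast+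

theorem theorem13:
  fixes r k m :: nat
  assumes "k \<ge> 3" and "m \<ge> r + k"
  shows "real (max_items k m r)
           \<le> (real k - 1) / (real r + real k - 1) * real (m choose (r + k - 2))
       \<and> (\<forall>n::nat.
            (int k - 1) * int (m choose (r + k - 1))
                - (int m - int r - int k + 1) * int (max_items k m r) \<le> int n
          \<and> int n \<le> (int k - 1) * int (m choose (r + k - 1))
          \<longrightarrow> int (min_weight n k m r) =
               (int r + int k - 1) * int n
               - \<lfloor>((real k - 1) * real (m choose (r + k - 1)) - real n)
                    / (real m - real r - real k + 1)\<rfloor>)"
proof -
  define s where "s = r + k - 1"
  define t where "t = m - s"
  define F where "F = max_items k m r"
  define T where "T = (k - 1) * (m choose s)"
  have s: "s \<ge> 2" "int s = int r + int k - 1" "real s = real r + real k - 1" "r + k - 2 = s - 1"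
    using assms(1) by (auto simp: s_def)
  have t: "t \<ge> 1" "int t = int m - int r - int k + 1" "real t = real m - real r - real k + 1"
    "m = s + t"
    using assms by (auto simp: s_def t_def)
  have T: "int T = (int k - 1) * int (m choose s)" "real T = (real k - 1) * real (m choose s)"
    using assms(1) by (auto simp: T_def of_nat_diff)
  obtain B where B: "small_code k m r F B"
    using max_items_small_code[OF assms] F_def by blast
  have Fk: "k \<le> F"
    using B by (simp add: ECBC_def)
  have FT: "F * (t + 1) \<le> T"
    using small_code_bound[OF _ assms(2) B] assms(1) by (simp add: T_def s_def t_def)
  \<comment> \<open>This identity turns the count over \<open>s\<close>-sets into the bound in terms of \<open>(s - 1)\<close>-sets.\<close>
  have absorb: "s * (m choose s) = (t + 1) * (m choose (s - 1))"
    using binomial_absorb_comp[of m "s - 1"] binomial_absorption[of "s - 1" m] s(1) t(4)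
    by simp
  have "(s * F) * (t + 1) \<le> ((k - 1) * (m choose (s - 1))) * (t + 1)"
  proof -
    have "(s * F) * (t + 1) \<le> s * T"
      using mult_le_mono2[OF FT, of s] by (simp only: mult.assoc)
    also have "\<dots> = (k - 1) * (s * (m choose s))"
      by (simp add: T_def)
    also have "\<dots> = ((k - 1) * (m choose (s - 1))) * (t + 1)"
      unfolding absorb by (simp only: ac_simps)
    finally show ?thesis .
  qed
  then have "s * F \<le> (k - 1) * (m choose (s - 1))"
    by (simp only: mult_le_cancel2)
  then have "real (s * F) \<le> real ((k - 1) * (m choose (s - 1)))"
    by (simp only: of_nat_le_iff)
  then have "real s * real F \<le> (real k - 1) * real (m choose (s - 1))"
    using assms(1) by (simp add: of_nat_diff)
  then have part1: "real F \<le> (real k - 1) / real s * real (m choose (s - 1))"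
    using s(1) by (simp add: field_simps)
  have part2: "int (min_weight n k m r) = int s * int n - \<lfloor>(real T - real n) / real t\<rfloor>"
    if lo: "int T - int t * int F \<le> int n" and hi: "int n \<le> int T" for n
  proof -
    define q where "q = (T - n) div t"
    have floor: "\<lfloor>(real T - real n) / real t\<rfloor> = int q"
    proof -
      have diff: "real T - real n = real (T - n)"
        using hi by (simp add: of_nat_diff)
      show ?thesis
        unfolding diff q_def by (rule floor_divide_of_nat_eq)
    qed
    have "int (T - n) \<le> int (F * t)"
      using lo hi by (simp add: of_nat_diff mult.commute)
    then have Tn: "T - n \<le> F * t"
      by (simp only: of_nat_le_iff)
    have "q \<le> F * t div t"
      unfolding q_def by (rule div_le_mono[OF Tn])
    then have qF: "q \<le> F"
      using t(1) by simp
    \<comment> \<open>The assumed range of \<open>n\<close> lies above \<open>F\<close>, hence above \<open>k\<close>, as a code on \<open>n\<close> items requires.\<close>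
    have "F \<le> n"
      using FT Tn unfolding distrib_left by linarith
    then have n: "k \<le> n" "q \<le> n"
      using Fk qF by simp_all
    have "t * q \<le> T - n"
      by (simp add: q_def)
    then have room: "n + t * q \<le> T"
      using hi by linarith
    have "\<exists>B'. ECBC r n k m B' \<and> weight m B' + q = (r + k - 1) * n"
    proof (rule ex_code_with_small_columns[where A = "column m B"])
      show "expanding r k {1..q} (column m B)"
        using B qF by (intro expanding_subset[OF ECBC_imp_expanding]) auto
      show "column m B j \<subseteq> {1..m} \<and> card (column m B j) = r + k - 2" if "j \<in> {1..q}" for j
        using B qF that column_subset by auto
    qed (use assms n room in \<open>auto simp: T_def s_def t_def\<close>)
    then obtain B' where B': "ECBC r n k m B'" "weight m B' + q = s * n"
      unfolding s_def by blast
    have "weight m B' \<le> weight m D" if "ECBC r n k m D" for D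
    proof -
      have "int t * (int s * int n - int (weight m D)) \<le> int T - int n"
        using weight_deficit_le[OF that assms(2)] t(4)
        unfolding T_def[symmetric] s_def[symmetric] by simp
      moreover have "T - n < t * Suc q"
        using dividend_less_times_div[of t "T - n"] t(1) by (simp add: q_def)
      then have "int (T - n) < int (t * Suc q)"
        by (simp only: of_nat_less_iff)
      then have "int T - int n < int t * (int q + 1)"
        using hi by (simp add: of_nat_diff algebra_simps)
      ultimately have "int t * (int s * int n - int (weight m D)) < int t * (int q + 1)"
        by (rule le_less_trans)
      then have "int s * int n - int (weight m D) < int q + 1"
        using t(1) by (simp add: mult_less_cancel_left)
      moreover have "int (weight m B') + int q = int s * int n"
        using B'(2) by (metis of_nat_add of_nat_mult)
      ultimately show ?thesis
        by linarith
    qed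
    then have "min_weight n k m r = weight m B'"
      using B'(1) by (intro min_weight_eqI) auto
    then have "int (min_weight n k m r) + int q = int s * int n"
      using B'(2) by (metis of_nat_add of_nat_mult)
    then show ?thesis
      unfolding floor by simp
  qed
  show ?thesis
    using part1 part2 unfolding s(4) s_def[symmetric] F_def[symmetric]
    unfolding s(2,3)[symmetric] t(2,3)[symmetric] T[symmetric] by blast
qed

end
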